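(* Let $B$ be a non-regular $2$-connected graph with $\Delta(B)=t$, whose edges are properly colored with colors $1,\dots,t$. If $C$ is a $t$-alternating cycle of $B$ all of whose vertices have degree $t$ in $B$, then there is a $t$-alternating $(\mathrm{ear},C)$-subgraph $H=P_0\cup\dots\cup P_n$ of $B$ with $P_0=C$ and $n\geq 0$, such that either (i) $H$ contains a vertex $x$ with $d_B(x)<t$, or (ii) there is a $t$-alternating path $P_{n+1}$ in $B$ from a vertex $y$ of $H$ to a vertex $x$ with $d_B(x)<t$, such that $y$ is the only common vertex of $P_{n+1}$ and $H$, and $P_{n+1}$ contains the edge colored $t$ incident with $x$, if such an edge exists.
   Context: Graphs are finite and simple. In a properly edge-colored graph, a path or cycle is $t$-alternating if, of any two consecutive edges on it, one has color $t$; it is $(c,t)$-colored if its edges are alternately colored $c$ and $t$. Let $B$ be properly colored with colors $1,\dots,t$, $t=\Delta(B)$, and let $C$ be a $t$-alternating cycle in $B$. A subgraph $H$ of $B$ is a $t$-alternating $(\mathrm{ear},C)$-subgraph if $H=P_0\cup\dots\cup P_n$ for some $n\geq 0$, where $P_0=C$ and, for each $i=1,\dots,n$, $P_i$ is a $(c_i,t)$-colored path for some color $c_i\leq t-1$ which is an ear of $P_0\cup\dots\cup P_i$, i.e., the endpoints of $P_i$ lie in $P_0\cup\dots\cup P_{i-1}$ and its internal vertices have degree $2$ in $P_0\cup\dots\cup P_i$. A graph is non-regular if not all its vertices have the same degree. *)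

theory Defs
  imports Main
begin

record 'a sgraph =
  verts :: "'a set"
  edges :: "'a set set"

definition finite_simple_graph :: "'a sgraph \<Rightarrow> bool" where
  "finite_simple_graph G \<longleftrightarrow>
     finite (verts G) \<and> (\<forall>e\<in>edges G. e \<subseteq> verts G \<and> card e = 2)"

definition subgraph :: "'a sgraph \<Rightarrow> 'a sgraph \<Rightarrow> bool" where
  "subgraph H G \<longleftrightarrow>
     finite_simple_graph H \<and> verts H \<subseteq> verts G \<and> edges H \<subseteq> edges G"

definition delete_verts :: "'a sgraph \<Rightarrow> 'a set \<Rightarrow> 'a sgraph" where
  "delete_verts G X = \<lparr>verts = verts G - X, edges = {e \<in> edges G. e \<inter> X = {}}\<rparr>"

definition vdegree :: "'a sgraph \<Rightarrow> 'a \<Rightarrow> nat" where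
  "vdegree G v = card {e \<in> edges G. v \<in> e}"

definition max_degree :: "'a sgraph \<Rightarrow> nat" where
  "max_degree G = Max (vdegree G ` verts G)"

definition regular_graph :: "'a sgraph \<Rightarrow> bool" where
  "regular_graph G \<longleftrightarrow> (\<exists>k. \<forall>v\<in>verts G. vdegree G v = k)"

text \<open>A path is given by its sequence of vertices, a cycle by its sequence of vertices
  without repeating the first one at the end.\<close>

definition edge_list :: "'a list \<Rightarrow> 'a set list" where
  "edge_list p = map (\<lambda>(u, v). {u, v}) (zip p (tl p))"

definition cycle_edge_list :: "'a list \<Rightarrow> 'a set list" where
  "cycle_edge_list p = edge_list (p @ [hd p])"

definition is_path :: "'a sgraph \<Rightarrow> 'a list \<Rightarrow> bool" where
  "is_path G p \<longleftrightarrow>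
     p \<noteq> [] \<and> distinct p \<and> set p \<subseteq> verts G \<and> set (edge_list p) \<subseteq> edges G"

definition is_cycle :: "'a sgraph \<Rightarrow> 'a list \<Rightarrow> bool" where
  "is_cycle G p \<longleftrightarrow>
     length p \<ge> 3 \<and> distinct p \<and> set p \<subseteq> verts G \<and> set (cycle_edge_list p) \<subseteq> edges G"

definition connected_graph :: "'a sgraph \<Rightarrow> bool" where
  "connected_graph G \<longleftrightarrow> verts G \<noteq> {} \<and>
     (\<forall>u\<in>verts G. \<forall>v\<in>verts G. \<exists>p. is_path G p \<and> hd p = u \<and> last p = v)"

definition k_connected :: "nat \<Rightarrow> 'a sgraph \<Rightarrow> bool" where
  "k_connected k G \<longleftrightarrow> card (verts G) > k \<and>
     (\<forall>X \<subseteq> verts G. card X < k \<longrightarrow> connected_graph (delete_verts G X))"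

definition proper_edge_coloring :: "'a sgraph \<Rightarrow> nat \<Rightarrow> ('a set \<Rightarrow> nat) \<Rightarrow> bool" where
  "proper_edge_coloring G t f \<longleftrightarrow> (\<forall>e\<in>edges G. f e \<in> {1..t}) \<and>
     (\<forall>e\<in>edges G. \<forall>e'\<in>edges G. e \<noteq> e' \<and> e \<inter> e' \<noteq> {} \<longrightarrow> f e \<noteq> f e')"

definition alternating_path :: "'a sgraph \<Rightarrow> ('a set \<Rightarrow> nat) \<Rightarrow> nat \<Rightarrow> 'a list \<Rightarrow> bool" where
  "alternating_path G f t p \<longleftrightarrow> is_path G p \<and>
     (\<forall>i. Suc i < length (edge_list p) \<longrightarrow>
        f (edge_list p ! i) = t \<or> f (edge_list p ! Suc i) = t)"

definition alternating_cycle :: "'a sgraph \<Rightarrow> ('a set \<Rightarrow> nat) \<Rightarrow> nat \<Rightarrow> 'a list \<Rightarrow> bool" where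
  "alternating_cycle G f t p \<longleftrightarrow> is_cycle G p \<and>
     (\<forall>i < length (cycle_edge_list p).
        f (cycle_edge_list p ! i) = t \<or>
        f (cycle_edge_list p ! (Suc i mod length (cycle_edge_list p))) = t)"

definition two_colored_path ::
    "'a sgraph \<Rightarrow> ('a set \<Rightarrow> nat) \<Rightarrow> nat \<Rightarrow> nat \<Rightarrow> 'a list \<Rightarrow> bool" where
  "two_colored_path G f c t p \<longleftrightarrow> is_path G p \<and>
     (\<forall>e \<in> set (edge_list p). f e \<in> {c, t}) \<and>
     (\<forall>i. Suc i < length (edge_list p) \<longrightarrow>
        f (edge_list p ! i) \<noteq> f (edge_list p ! Suc i))"

text \<open>The union of the cycle \<open>C\<close> with the paths in the list \<open>Ps\<close>. As \<open>C\<close> plays the role of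
  \<open>P\<^sub>0\<close>, the ear \<open>P\<^sub>i\<close> is \<open>Ps ! (i - 1)\<close>, and \<open>P\<^sub>0 \<union> \<dots> \<union> P\<^sub>i\<close> is \<open>ear_union C (take i Ps)\<close>.\<close>

definition ear_union :: "'a list \<Rightarrow> 'a list list \<Rightarrow> 'a sgraph" where
  "ear_union C Ps =
     \<lparr>verts = set C \<union> (\<Union>P\<in>set Ps. set P),
      edges = set (cycle_edge_list C) \<union> (\<Union>P\<in>set Ps. set (edge_list P))\<rparr>"

definition ear_subgraph ::
    "'a sgraph \<Rightarrow> ('a set \<Rightarrow> nat) \<Rightarrow> nat \<Rightarrow> 'a list \<Rightarrow> 'a sgraph \<Rightarrow> bool" where
  "ear_subgraph G f t C H \<longleftrightarrow> subgraph H G \<and>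
     (\<exists>Ps. H = ear_union C Ps \<and>
       (\<forall>i \<in> {1..length Ps}. let P = Ps ! (i - 1) in
          length P \<ge> 2 \<and>
          (\<exists>c \<in> {1..t - 1}. two_colored_path G f c t P) \<and>
          hd P \<in> verts (ear_union C (take (i - 1) Ps)) \<and>
          last P \<in> verts (ear_union C (take (i - 1) Ps)) \<and>
          (\<forall>v \<in> set (butlast (tl P)). vdegree (ear_union C (take i Ps)) v = 2)))"

end

theory Submission
  imports Defs
begin

text \<open>
  Build the ears greedily, keeping the vertex set \<open>S\<close> of the current subgraph closed under
  passing along edges of color \<open>t\<close>. This holds for \<open>C\<close>, whose vertices all meet an edge of
  color \<open>t\<close> on \<open>C\<close>. While \<open>S\<close> contains only vertices of degree \<open>t\<close>, some edge leaves \<open>S\<close>, and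
  its color \<open>c\<close> is not \<open>t\<close>. Follow the \<open>(c,t)\<close>-colored chain starting with this edge until it
  gets stuck or meets \<open>S\<close> again. If it gets stuck at \<open>x\<close>, then \<open>x\<close> misses \<open>c\<close> or \<open>t\<close>, so it has
  degree less than \<open>t\<close>, and the chain is the path of alternative (ii). If it returns to \<open>S\<close>, it
  does so along an edge of color \<open>c\<close> and at a vertex different from its start, so it is a new
  ear, and all its internal vertices have their edge of color \<open>t\<close> on it: the enlarged vertex set
  is closed again.
\<close>

section \<open>Edge lists of paths and cycles, by position\<close>

lemma length_edge_list [simp]: "length (edge_list p) = length p - 1"
  by (simp add: edge_list_def)

lemma nth_edge_list: "Suc i < length p \<Longrightarrow> edge_list p ! i = {p ! i, p ! Suc i}"
  by (simp add: edge_list_def nth_tl)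

lemma in_edge_list_iff:
  "e \<in> set (edge_list p) \<longleftrightarrow> (\<exists>i. Suc i < length p \<and> e = {p ! i, p ! Suc i})"
  unfolding in_set_conv_nth using nth_edge_list[of _ p]
  by (metis Suc_lessD length_edge_list less_diff_conv plus_1_eq_Suc add.commute)

lemma edge_list_subset: "e \<in> set (edge_list p) \<Longrightarrow> e \<subseteq> set p"
  by (auto simp: in_edge_list_iff)

lemma length_cycle_edge_list [simp]: "length (cycle_edge_list C) = length C"
  by (simp add: cycle_edge_list_def)

lemma nth_cycle_edge_list:
  assumes "i < length C"
  shows "cycle_edge_list C ! i = {C ! i, C ! (Suc i mod length C)}"
proof (cases "Suc i < length C")
  case True
  then show ?thesis
    by (simp add: cycle_edge_list_def nth_edge_list nth_append)
next
  case False
  with assms have "Suc i = length C" by simp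
  moreover from this have "hd C = C ! 0" by (intro hd_conv_nth) auto
  ultimately show ?thesis
    by (simp add: cycle_edge_list_def nth_edge_list nth_append)
qed

lemma cycle_edge_list_subset:
  assumes "e \<in> set (cycle_edge_list C)"
  shows "e \<subseteq> set C"
proof -
  obtain i where i: "i < length C" "e = cycle_edge_list C ! i"
    using assms by (auto simp: in_set_conv_nth)
  then have "Suc i mod length C < length C"
    by (intro mod_less_divisor) linarith
  then show ?thesis
    using i by (simp add: nth_cycle_edge_list)
qed

lemma card_edge_list_internal_vertex:
  assumes "distinct p" "0 < i" "Suc i < length p"
  shows "card {e \<in> set (edge_list p). p ! i \<in> e} = 2"
proof -
  obtain j where j: "i = Suc j" using assms(2) by (cases i) auto
  have "{e \<in> set (edge_list p). p ! i \<in> e} = {{p ! j, p ! i}, {p ! i, p ! Suc i}}"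
  proof
    show "{e \<in> set (edge_list p). p ! i \<in> e} \<subseteq> {{p ! j, p ! i}, {p ! i, p ! Suc i}}"
      using assms unfolding j by (auto simp: in_edge_list_iff nth_eq_iff_index_eq)
    have "edge_list p ! j \<in> set (edge_list p)" "edge_list p ! i \<in> set (edge_list p)"
      using assms j by (auto intro!: nth_mem)
    then show "{{p ! j, p ! i}, {p ! i, p ! Suc i}} \<subseteq> {e \<in> set (edge_list p). p ! i \<in> e}"
      using assms j by (simp add: nth_edge_list)
  qed
  moreover have "{p ! j, p ! i} \<noteq> {p ! i, p ! Suc i}"
    using assms j by (auto simp: doubleton_eq_iff nth_eq_iff_index_eq)
  ultimately show ?thesis by simp
qed

text \<open>Translates the list expression that \<open>ear_subgraph\<close> uses for internal
  vertices into positions, which is how \<open>chain\<close> speaks of them.\<close>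

lemma in_butlast_tl_iff:
  "v \<in> set (butlast (tl p)) \<longleftrightarrow> (\<exists>i. 0 < i \<and> Suc i < length p \<and> v = p ! i)"
proof
  assume "v \<in> set (butlast (tl p))"
  then obtain j where "j < length p - 2" "v = p ! Suc j"
    by (auto simp: in_set_conv_nth nth_butlast nth_tl numeral_2_eq_2)
  then have "Suc (Suc j) < length p" "v = p ! Suc j" by auto
  then show "\<exists>i. 0 < i \<and> Suc i < length p \<and> v = p ! i" by blast
next
  assume "\<exists>i. 0 < i \<and> Suc i < length p \<and> v = p ! i"
  then obtain j where "Suc (Suc j) < length p" "v = p ! Suc j"
    by (metis gr0_conv_Suc)
  then show "v \<in> set (butlast (tl p))"
    by (auto simp: in_set_conv_nth nth_butlast nth_tl intro!: exI[of _ j])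
qed

lemma list_crossing:
  assumes "p \<noteq> []" "hd p \<in> S" "last p \<notin> S"
  shows "\<exists>i. Suc i < length p \<and> p ! i \<in> S \<and> p ! Suc i \<notin> S"
proof (rule ccontr)
  assume *: "\<not> ?thesis"
  have "i < length p \<longrightarrow> p ! i \<in> S" for i
    using * assms by (induction i) (auto simp: hd_conv_nth)
  then show False
    using assms by (simp add: last_conv_nth)
qed

section \<open>Unions of the cycle with ears\<close>

lemma verts_ear_union_append [simp]:
  "verts (ear_union C (Ps @ [P])) = verts (ear_union C Ps) \<union> set P"
  by (auto simp: ear_union_def)

lemma edges_ear_union_append [simp]:
  "edges (ear_union C (Ps @ [P])) = edges (ear_union C Ps) \<union> set (edge_list P)"
  by (auto simp: ear_union_def)

lemma edges_ear_union_subset: "e \<in> edges (ear_union C Ps) \<Longrightarrow> e \<subseteq> verts (ear_union C Ps)"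
  using edge_list_subset cycle_edge_list_subset by (fastforce simp: ear_union_def)

lemma is_path_delete_verts_empty: "is_path (delete_verts G {}) p \<longleftrightarrow> is_path G p"
  by (simp add: is_path_def delete_verts_def)

section \<open>Properly colored graphs\<close>

locale properly_colored_graph =
  fixes B :: "'a sgraph" and t :: nat and f :: "'a set \<Rightarrow> nat"
  assumes fsg: "finite_simple_graph B"
    and proper: "proper_edge_coloring B t f"
begin

lemma edgeD: "{u, v} \<in> edges B \<Longrightarrow> u \<in> verts B \<and> v \<in> verts B \<and> u \<noteq> v"
  using fsg by (fastforce simp: finite_simple_graph_def)

lemma edge_color_unique:
  "e \<in> edges B \<Longrightarrow> e' \<in> edges B \<Longrightarrow> v \<in> e \<Longrightarrow> v \<in> e' \<Longrightarrow> f e = f e' \<Longrightarrow> e = e'"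
  using proper unfolding proper_edge_coloring_def by blast

lemma edge_doubleton:
  assumes "e \<in> edges B" "v \<in> e"
  obtains w where "e = {v, w}"
  using assms fsg unfolding finite_simple_graph_def
  by (metis card_2_iff insert_commute insertE singletonD)

text \<open>By properness \<open>f\<close> is injective on the edges at \<open>x\<close>, and its
  values there avoid \<open>d\<close>, which leaves at most \<open>t - 1\<close> colors.\<close>

lemma missing_color_vdegree_less:
  assumes "d \<in> {1..t}" "\<forall>e\<in>edges B. x \<in> e \<longrightarrow> f e \<noteq> d"
  shows "vdegree B x < t"
proof -
  let ?E = "{e \<in> edges B. x \<in> e}"
  have "card ?E \<le> card ({1..t} - {d})"
  proof (rule card_inj_on_le[of f])
    show "inj_on f ?E" unfolding inj_on_def using edge_color_unique by blast
    show "f ` ?E \<subseteq> {1..t} - {d}"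
      using assms proper by (auto simp: proper_edge_coloring_def)
  qed simp
  also have "\<dots> < t" using assms(1) by simp
  finally show ?thesis by (simp add: vdegree_def)
qed

section \<open>Color-closed sets and alternating chains\<close>

definition color_closed :: "'a set \<Rightarrow> bool" where
  "color_closed S \<longleftrightarrow> (\<forall>e\<in>edges B. f e = t \<and> e \<inter> S \<noteq> {} \<longrightarrow> e \<subseteq> S)"

text \<open>At each vertex of the cycle one of its two cycle edges has color \<open>t\<close>; by
  properness no other edge at that vertex does.\<close>

lemma color_closed_alternating_cycle:
  assumes "alternating_cycle B f t C"
  shows "color_closed (set C)"
  unfolding color_closed_def
proof (intro ballI impI, elim conjE)
  fix e assume e: "e \<in> edges B" "f e = t" "e \<inter> set C \<noteq> {}"
  let ?n = "length C" and ?L = "cycle_edge_list C"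
  obtain j where j: "j < ?n" "C ! j \<in> e"
    using e(3) by (auto simp: in_set_conv_nth)
  \<comment> \<open>Position \<open>i\<close> is the cyclic predecessor of \<open>j\<close>, so the
    cycle edges \<open>i\<close> and \<open>j\<close> are the two that meet at
    \<open>C ! j\<close>.\<close>
  define i where "i = (if j = 0 then ?n - 1 else j - 1)"
  have i: "i < ?n" "Suc i mod ?n = j"
    using j by (auto simp: i_def)
  have "f (?L ! i) = t \<or> f (?L ! j) = t"
    using assms i by (auto simp: alternating_cycle_def)
  moreover have "C ! j \<in> ?L ! i" "C ! j \<in> ?L ! j"
    using i j by (simp_all add: nth_cycle_edge_list)
  moreover have L: "?L ! i \<in> set ?L" "?L ! j \<in> set ?L"
    using i j by simp_all
  moreover have "set ?L \<subseteq> edges B"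
    using assms by (simp add: alternating_cycle_def is_cycle_def)
  ultimately have "e = ?L ! i \<or> e = ?L ! j"
    using e j edge_color_unique by (metis subsetD)
  then show "e \<subseteq> set C"
    using L cycle_edge_list_subset by metis
qed

text \<open>The last vertex may lie inside or outside \<open>S\<close>, so one notion serves chains
  that get stuck and chains that return; distinctness makes a return end away from the start. Colors
  go by the parity of the position, so the length determines the color of a next edge.\<close>

definition chain :: "'a set \<Rightarrow> nat \<Rightarrow> 'a list \<Rightarrow> bool" where
  "chain S c p \<longleftrightarrow> 2 \<le> length p \<and> distinct p \<and> hd p \<in> S \<and>
     (\<forall>i. 0 < i \<and> Suc i < length p \<longrightarrow> p ! i \<notin> S) \<and>
     (\<forall>i. Suc i < length p \<longrightarrow>
        {p ! i, p ! Suc i} \<in> edges B \<and> f {p ! i, p ! Suc i} = (if even i then c else t))"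

lemma chain_nonempty: "chain S c p \<Longrightarrow> p \<noteq> []"
  by (auto simp: chain_def)

lemma chain_is_path: "chain S c p \<Longrightarrow> is_path B p"
proof -
  assume p: "chain S c p"
  have "set (edge_list p) \<subseteq> edges B"
    using p by (auto simp: in_edge_list_iff chain_def)
  moreover have "v \<in> verts B" if v: "v \<in> set p" for v
  proof -
    obtain i where i: "i < length p" "v = p ! i" using v by (auto simp: in_set_conv_nth)
    show ?thesis
    proof (cases "Suc i < length p")
      case True
      then show ?thesis using p i edgeD by (auto simp: chain_def)
    next
      case False
      then obtain j where "i = Suc j" using i p by (cases i) (auto simp: chain_def)
      then show ?thesis using p i edgeD by (auto simp: chain_def)
    qed
  qed
  ultimately show ?thesis using p by (auto simp: is_path_def chain_def)
qed

lemma chain_two_colored_path: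
  assumes "chain S c p" "c \<noteq> t"
  shows "two_colored_path B f c t p"
proof -
  have "\<forall>e \<in> set (edge_list p). f e \<in> {c, t}"
  proof
    fix e assume "e \<in> set (edge_list p)"
    then obtain i where "Suc i < length p" "e = {p ! i, p ! Suc i}"
      by (auto simp: in_edge_list_iff)
    then have "f e = (if even i then c else t)" using assms(1) by (simp add: chain_def)
    then show "f e \<in> {c, t}" by simp
  qed
  moreover have "f (edge_list p ! i) \<noteq> f (edge_list p ! Suc i)"
    if "Suc i < length (edge_list p)" for i
  proof -
    have "Suc i < length p" "Suc (Suc i) < length p" using that by auto
    then show ?thesis using assms unfolding chain_def by (simp add: nth_edge_list)
  qed
  ultimately show ?thesis
    using chain_is_path[OF assms(1)] by (auto simp: two_colored_path_def)
qed

lemma two_colored_alternating_path: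
  assumes "two_colored_path B f c t p"
  shows "alternating_path B f t p"
  unfolding alternating_path_def
proof (intro conjI allI impI)
  show "is_path B p" using assms by (simp add: two_colored_path_def)
  fix i assume i: "Suc i < length (edge_list p)"
  then have "edge_list p ! i \<in> set (edge_list p)" "edge_list p ! Suc i \<in> set (edge_list p)"
    by (meson Suc_lessD nth_mem)+
  then show "f (edge_list p ! i) = t \<or> f (edge_list p ! Suc i) = t"
    using assms i unfolding two_colored_path_def
    by (metis insertE singletonD)
qed

text \<open>If \<open>w\<close> were on the chain, some chain edge at \<open>w\<close> would already
  have the color of the new edge and hence, by properness, be the new edge. It would then contain
  \<open>last p\<close>, so it would be the last chain edge, but that one has the other
  color.\<close>

lemma chain_extension_fresh:
  assumes p: "chain S c p" and cl: "color_closed S" and c: "c \<noteq> t"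
    and x: "last p \<notin> S"
    and e: "{last p, w} \<in> edges B"
    and col: "f {last p, w} = (if even (length p - 1) then c else t)"
  shows "w \<notin> set p"
proof
  assume "w \<in> set p"
  then obtain i where i: "i < length p" "w = p ! i" by (auto simp: in_set_conv_nth)
  define n where "n = length p - 1"
  have n: "length p = Suc n" "0 < n" "last p = p ! n" and d: "distinct p"
    using p chain_nonempty[OF p] by (auto simp: n_def chain_def last_conv_nth)
  have E: "{p ! j, p ! Suc j} \<in> edges B" "f {p ! j, p ! Suc j} = (if even j then c else t)"
    if "j < n" for j using p that n by (auto simp: chain_def)
  have "w \<noteq> last p" using e edgeD by blast
  with i n have "i < n" by (metis less_SucE)
  \<comment> \<open>Of the chain edges at positions \<open>i\<close> and \<open>i - 1\<close>, both
    at \<open>w\<close>, one has the parity of \<open>n\<close>. The edge \<open>i - 1\<close> is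
    absent only for \<open>i = 0\<close>; if it is wanted there, the new edge has color
    \<open>t\<close> and leaves \<open>S\<close>, against closure.\<close>
  have ex: "\<exists>j<n. w \<in> {p ! j, p ! Suc j} \<and> f {p ! j, p ! Suc j} = f {last p, w}"
  proof (cases "even i = even n")
    case True
    then have "f {p ! i, p ! Suc i} = f {last p, w}" using E(2)[of i] \<open>i < n\<close> col n by simp
    then show ?thesis using \<open>i < n\<close> i by blast
  next
    case False
    show ?thesis
    proof (cases i)
      case 0
      then have "w \<in> S" using p i by (auto simp: chain_def hd_conv_nth)
      moreover have "f {last p, w} = t" using False 0 col n by simp
      ultimately show ?thesis using cl e x by (auto simp: color_closed_def)
    next
      case (Suc j)
      then have "f {p ! j, p ! Suc j} = f {last p, w}"
        using E(2)[of j] False \<open>i < n\<close> col n by simp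
      then show ?thesis using \<open>i < n\<close> i Suc by (intro exI[of _ j]) simp
    qed
  qed
  then obtain j where j: "j < n" "w \<in> {p ! j, p ! Suc j}"
    "f {p ! j, p ! Suc j} = f {last p, w}" by blast
  then have eq: "{p ! j, p ! Suc j} = {last p, w}"
    using E(1)[OF j(1)] e by (intro edge_color_unique[of _ _ w]) auto
  \<comment> \<open>Only the chain edge at position \<open>n - 1\<close> contains
    \<open>p ! n\<close>, so \<open>j\<close> and \<open>n\<close> differ in parity, whereas equal
    colors force equal parity because \<open>c\<close> and \<open>t\<close> differ.\<close>
  then have "p ! n \<in> {p ! j, p ! Suc j}" using n by auto
  then have "n = Suc j" using d j n by (auto simp: nth_eq_iff_index_eq)
  moreover have "even j = even n"
    using E(2)[OF j(1)] j(3) col n c by (auto split: if_splits)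
  ultimately show False by simp
qed

text \<open>\<open>last p\<close> becomes an internal vertex and so must avoid \<open>S\<close>;
  \<open>w\<close> may lie in \<open>S\<close>, which is how a chain closes into an ear.\<close>

lemma chain_snoc:
  assumes p: "chain S c p" and x: "last p \<notin> S" and w: "w \<notin> set p"
    and e: "{last p, w} \<in> edges B"
    and col: "f {last p, w} = (if even (length p - 1) then c else t)"
  shows "chain S c (p @ [w])"
proof -
  define n where "n = length p - 1"
  have n: "length p = Suc n" "last p = p ! n" "p \<noteq> []"
    using p chain_nonempty[OF p] by (auto simp: n_def chain_def last_conv_nth)
  then show ?thesis
    using p x w e col n unfolding chain_def
    by (auto simp: nth_append less_Suc_eq)
qed

section \<open>Sequences of ears\<close>

definition ear :: "'a list \<Rightarrow> 'a list list \<Rightarrow> 'a list \<Rightarrow> bool" where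
  "ear C Ps P \<longleftrightarrow> length P \<ge> 2 \<and>
     (\<exists>c \<in> {1..t - 1}. two_colored_path B f c t P) \<and>
     hd P \<in> verts (ear_union C Ps) \<and> last P \<in> verts (ear_union C Ps) \<and>
     (\<forall>v \<in> set (butlast (tl P)). vdegree (ear_union C (Ps @ [P])) v = 2)"

text \<open>The ear condition of \<open>ear_subgraph\<close>, indexed from 0. Each ear is judged
  only against the prefix before it, so appending an ear leaves the earlier conditions
  untouched.\<close>

definition ears :: "'a list \<Rightarrow> 'a list list \<Rightarrow> bool" where
  "ears C Ps \<longleftrightarrow> (\<forall>i < length Ps. ear C (take i Ps) (Ps ! i))"

lemma ears_snoc: "ears C Ps \<Longrightarrow> ear C Ps P \<Longrightarrow> ears C (Ps @ [P])"
  by (auto simp: ears_def nth_append less_Suc_eq)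

lemma ears_verts_subset:
  assumes "ears C Ps" "set C \<subseteq> verts B"
  shows "verts (ear_union C Ps) \<subseteq> verts B"
proof -
  have "set P \<subseteq> verts B" if "P \<in> set Ps" for P
    using that assms(1)
    by (auto simp: in_set_conv_nth ears_def ear_def two_colored_path_def is_path_def)
  then show ?thesis using assms(2) by (auto simp: ear_union_def)
qed

lemma ears_subgraph:
  assumes "ears C Ps" "is_cycle B C"
  shows "subgraph (ear_union C Ps) B"
proof -
  have "set (edge_list P) \<subseteq> edges B" if "P \<in> set Ps" for P
    using that assms(1)
    by (auto simp: in_set_conv_nth ears_def ear_def two_colored_path_def is_path_def)
  then have E: "edges (ear_union C Ps) \<subseteq> edges B"
    using assms(2) by (auto simp: ear_union_def is_cycle_def)
  have V: "verts (ear_union C Ps) \<subseteq> verts B"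
    using ears_verts_subset assms by (simp add: is_cycle_def)
  show ?thesis
    using E V fsg edges_ear_union_subset[of _ C Ps] finite_subset[OF V]
    unfolding subgraph_def finite_simple_graph_def by blast
qed

lemma ears_ear_subgraph:
  assumes "ears C Ps" "is_cycle B C"
  shows "ear_subgraph B f t C (ear_union C Ps)"
proof -
  have "let P = Ps ! (i - 1) in
          length P \<ge> 2 \<and>
          (\<exists>c \<in> {1..t - 1}. two_colored_path B f c t P) \<and>
          hd P \<in> verts (ear_union C (take (i - 1) Ps)) \<and>
          last P \<in> verts (ear_union C (take (i - 1) Ps)) \<and>
          (\<forall>v \<in> set (butlast (tl P)). vdegree (ear_union C (take i Ps)) v = 2)"
    if i: "i \<in> {1..length Ps}" for i
  proof -
    obtain j where j: "i = Suc j" "j < length Ps" using i by (cases i) auto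
    then have "ear C (take j Ps) (Ps ! j)" using assms by (simp add: ears_def)
    then show ?thesis
      using j by (simp add: ear_def take_Suc_conv_app_nth Let_def)
  qed
  then show ?thesis
    unfolding ear_subgraph_def using ears_subgraph[OF assms] by blast
qed

text \<open>Internal vertices of \<open>p\<close> are new, so no old edge meets them and in the
  enlarged union they carry just their two chain edges.\<close>

lemma chain_ear:
  assumes p: "chain (verts (ear_union C Ps)) c p" and c: "c \<in> {1..t - 1}"
    and l: "last p \<in> verts (ear_union C Ps)"
  shows "ear C Ps p"
proof -
  let ?S = "verts (ear_union C Ps)"
  have "vdegree (ear_union C (Ps @ [p])) v = 2" if v: "v \<in> set (butlast (tl p))" for v
  proof -
    obtain i where i: "0 < i" "Suc i < length p" "v = p ! i"
      using v unfolding in_butlast_tl_iff by blast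
    then have "v \<notin> ?S" using p by (auto simp: chain_def)
    then have "{e \<in> edges (ear_union C (Ps @ [p])). v \<in> e} = {e \<in> set (edge_list p). p ! i \<in> e}"
      using edges_ear_union_subset i by auto
    then show ?thesis
      using card_edge_list_internal_vertex[of p i] p i by (simp add: vdegree_def chain_def)
  qed
  moreover have "two_colored_path B f c t p"
    using chain_two_colored_path[OF p] c by auto
  ultimately show ?thesis
    using p l c unfolding ear_def chain_def by blast
qed

section \<open>Growing the closed set, and the induction\<close>

lemma color_closed_chain:
  assumes p: "chain S c p" and cl: "color_closed S" and l: "last p \<in> S"
  shows "color_closed (S \<union> set p)"
  unfolding color_closed_def
proof (intro ballI impI, elim conjE)
  fix e assume e: "e \<in> edges B" "f e = t" "e \<inter> (S \<union> set p) \<noteq> {}"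
  show "e \<subseteq> S \<union> set p"
  proof (cases "e \<inter> S = {}")
    case False
    then show ?thesis using cl e by (auto simp: color_closed_def)
  next
    case True
    then obtain i where i: "i < length p" "p ! i \<in> e"
      using e by (auto simp: in_set_conv_nth)
    define n where "n = length p - 1"
    have n: "length p = Suc n" "p ! n \<in> S" "p ! 0 \<in> S"
      using p l chain_nonempty[OF p] by (auto simp: n_def chain_def last_conv_nth hd_conv_nth)
    \<comment> \<open>Both ends of \<open>p\<close> lie in \<open>S\<close>, which \<open>e\<close>
      misses, so \<open>p ! i\<close> is internal. One of its two chain edges has color
      \<open>t\<close>, and by properness that edge is \<open>e\<close>.\<close>
    have "i \<noteq> n" "i \<noteq> 0" using True n i by (metis IntI empty_iff)+
    then obtain j where j: "i = Suc j" "Suc i < length p" using i n by (cases i) auto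
    have "f {p ! j, p ! i} = t \<or> f {p ! i, p ! Suc i} = t"
      "{p ! j, p ! i} \<in> edges B" "{p ! i, p ! Suc i} \<in> edges B"
      using p j by (auto simp: chain_def)
    then have "e = {p ! j, p ! i} \<or> e = {p ! i, p ! Suc i}"
      using edge_color_unique[OF e(1) _ i(2)] e(2) by (metis insertI1 insert_commute)
    then show ?thesis using i j by auto
  qed
qed

text \<open>Take a longest chain ending outside \<open>S\<close>. If its end has an edge of the next
  color, that edge reaches a new vertex, which lies in \<open>S\<close> by maximality;
  \<open>2 < length p\<close> records that the returning chain has an internal vertex. Otherwise the
  end misses a color.\<close>

lemma leaving_chain:
  assumes cl: "color_closed S" and e: "{y, z} \<in> edges B" and y: "y \<in> S" and z: "z \<notin> S"
  obtains c p where "c \<in> {1..t - 1}" "chain S c p" "last p \<in> S" "2 < length p"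
    | c p where "c \<in> {1..t - 1}" "chain S c p" "last p \<notin> S" "vdegree B (last p) < t"
        "\<forall>e\<in>edges B. f e = t \<and> last p \<in> e \<longrightarrow> e \<in> set (edge_list p)"
proof -
  define c where "c = f {y, z}"
  have "c \<noteq> t" using cl e y z by (auto simp: color_closed_def c_def)
  moreover have ct: "c \<in> {1..t}" using proper e by (auto simp: proper_edge_coloring_def c_def)
  ultimately have c: "c \<in> {1..t - 1}" "c \<noteq> t" by auto
  let ?Q = "\<lambda>p. chain S c p \<and> last p \<notin> S"
  have "chain S c [y, z]" using e y edgeD by (auto simp: chain_def c_def)
  then have Q0: "?Q [y, z]" using z by simp
  have "\<forall>p. ?Q p \<longrightarrow> length p < Suc (card (verts B))"
  proof (intro allI impI)
    fix p assume "?Q p"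
    then have "distinct p" "set p \<subseteq> verts B" using chain_is_path by (auto simp: is_path_def)
    moreover have "finite (verts B)" using fsg by (simp add: finite_simple_graph_def)
    ultimately show "length p < Suc (card (verts B))"
      by (metis card_mono distinct_card less_Suc_eq_le)
  qed
  with Q0 obtain p where p: "?Q p" and max: "\<And>q. ?Q q \<Longrightarrow> length q \<le> length p"
    using ex_has_greatest_nat[of ?Q _ length] by blast
  \<comment> \<open>The last edge of \<open>p\<close> has position \<open>length p - 2\<close>, so
    \<open>?d\<close> is the color that a next edge must have.\<close>
  let ?d = "if even (length p - 1) then c else t"
  define n where "n = length p - 1"
  have n: "length p = Suc n" "0 < n" "last p = p ! n"
    using p chain_nonempty[of S c p] by (auto simp: n_def chain_def last_conv_nth)
  show ?thesis
  proof (cases "\<exists>e\<in>edges B. last p \<in> e \<and> f e = ?d")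
    case True
    then obtain w where w: "{last p, w} \<in> edges B" "f {last p, w} = ?d"
      by (metis edge_doubleton)
    then have "w \<notin> set p" using chain_extension_fresh p cl c by blast
    then have "chain S c (p @ [w])" using chain_snoc p w by blast
    moreover from this have "w \<in> S" using max[of "p @ [w]"] by fastforce
    ultimately show ?thesis using that(1)[of c "p @ [w]"] c n by simp
  next
    case False
    have "?d \<in> {1..t}" using ct by auto
    then have "vdegree B (last p) < t" using missing_color_vdegree_less[of ?d] False by blast
    moreover have "e \<in> set (edge_list p)" if e: "e \<in> edges B" "f e = t" "last p \<in> e" for e
    proof -
      \<comment> \<open>No edge at \<open>last p\<close> has color \<open>?d\<close>, so an edge of
        color \<open>t\<close> there forces \<open>?d\<close> to be \<open>c\<close> and
        \<open>n\<close> to be even. The last chain edge, at the odd position \<open>n - 1\<close>,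
        then has color \<open>t\<close>.\<close>
      have ev: "even n" using False e n by (metis diff_Suc_1)
      obtain m where m: "n = Suc m" using n by (cases n) auto
      have E: "{p ! m, p ! n} \<in> edges B" "f {p ! m, p ! n} = t"
        using p m n ev by (auto simp: chain_def)
      then have "e = {p ! m, p ! n}"
        using e n by (intro edge_color_unique[of _ _ "p ! n"]) auto
      then show ?thesis using m n by (auto simp: in_edge_list_iff)
    qed
    ultimately show ?thesis using that(2)[of c p] c p by blast
  qed
qed

lemma exists_leaving_edge:
  assumes "connected_graph (delete_verts B {})" "u \<in> S" "u \<in> verts B" "v \<in> verts B" "v \<notin> S"
  obtains y z where "{y, z} \<in> edges B" "y \<in> S" "z \<notin> S"
proof -
  have "\<forall>a\<in>verts B. \<forall>b\<in>verts B. \<exists>p. is_path B p \<and> hd p = a \<and> last p = b"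
    using assms(1) by (simp add: connected_graph_def is_path_delete_verts_empty) (simp add: delete_verts_def)
  then obtain p where p: "is_path B p" "hd p = u" "last p = v"
    using assms by blast
  then obtain i where i: "Suc i < length p" "p ! i \<in> S" "p ! Suc i \<notin> S"
    using list_crossing[of p S] assms by (auto simp: is_path_def)
  moreover have "{p ! i, p ! Suc i} \<in> edges B"
    using p(1) i(1) in_edge_list_iff[of _ p] unfolding is_path_def by blast
  ultimately show ?thesis using that by blast
qed

text \<open>Induction on the number of vertices outside the union, steered by the fixed vertex
  \<open>v\<close>: while \<open>v\<close> is outside, connectedness supplies a leaving edge. A
  returning chain enlarges the union, a stuck chain gives the second alternative, and absorbing
  \<open>v\<close> gives the first.\<close>

lemma ear_subgraph_reaching_low_degree:
  assumes conn: "connected_graph (delete_verts B {})"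
    and v: "v \<in> verts B" "vdegree B v < t"
    and C: "is_cycle B C"
    and "ears C Ps" "color_closed (verts (ear_union C Ps))"
  shows "\<exists>H. ear_subgraph B f t C H \<and>
    ((\<exists>x\<in>verts H. vdegree B x < t) \<or>
     (\<exists>P x y. alternating_path B f t P \<and> hd P = y \<and> last P = x \<and>
        y \<in> verts H \<and> vdegree B x < t \<and> set P \<inter> verts H = {y} \<and>
        (\<forall>e\<in>edges B. f e = t \<and> x \<in> e \<longrightarrow> e \<in> set (edge_list P))))"
  using assms(5,6)
proof (induction "card (verts B) - card (verts (ear_union C Ps))" arbitrary: Ps
    rule: less_induct)
  case less
  let ?H = "ear_union C Ps"
  let ?S = "verts ?H"
  have H: "ear_subgraph B f t C ?H" using ears_ear_subgraph less.prems C by blast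
  show ?case
  proof (cases "v \<in> ?S")
    case True
    then show ?thesis using H v by blast
  next
    case False
    have CB: "set C \<subseteq> verts B" and "C \<noteq> []" using C by (auto simp: is_cycle_def)
    then have "hd C \<in> ?S" "hd C \<in> verts B" by (auto simp: ear_union_def)
    then obtain y z where yz: "{y, z} \<in> edges B" "y \<in> ?S" "z \<notin> ?S"
      using exists_leaving_edge[OF conn] v False by blast
    from leaving_chain[OF less.prems(2) yz] show ?thesis
    proof cases
      case (1 c p)
      let ?Ps = "Ps @ [p]"
      have E: "ears C ?Ps" using 1 chain_ear ears_snoc less.prems by blast
      have cl: "color_closed (verts (ear_union C ?Ps))"
        using color_closed_chain 1 less.prems by simp
      have fin: "finite (verts B)" using fsg by (simp add: finite_simple_graph_def)
      have sub: "verts (ear_union C ?Ps) \<subseteq> verts B" using ears_verts_subset[OF E CB] .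
      \<comment> \<open>Since \<open>2 < length p\<close>, the vertex \<open>p ! 1\<close> is
        internal and therefore new, so the measure drops strictly.\<close>
      have "p ! 1 \<in> set p" "p ! 1 \<notin> ?S" using 1 by (auto simp: chain_def)
      then have "?S \<subset> verts (ear_union C ?Ps)" by auto
      then have "card ?S < card (verts (ear_union C ?Ps))"
        "card (verts (ear_union C ?Ps)) \<le> card (verts B)"
        using sub fin by (auto intro: psubset_card_mono card_mono finite_subset)
      then show ?thesis using less.hyps[of ?Ps] E cl by force
    next
      case (2 c p)
      have "c \<noteq> t" using 2 by auto
      then have "alternating_path B f t p"
        using 2 chain_two_colored_path two_colored_alternating_path by blast
      moreover have "set p \<inter> ?S = {hd p}"
      proof -
        \<comment> \<open>Internal vertices of a chain avoid \<open>?S\<close>, and in this case so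
          does the last vertex; only the start remains.\<close>
        have "w = hd p" if w: "w \<in> set p" "w \<in> ?S" for w
        proof -
          obtain i where i: "i < length p" "w = p ! i" using w by (auto simp: in_set_conv_nth)
          have "p \<noteq> []" using i by auto
          moreover have "i \<noteq> length p - 1" using 2 w i \<open>p \<noteq> []\<close> by (auto simp: last_conv_nth)
          ultimately show ?thesis
            using 2(2) w i by (cases i) (auto simp: chain_def hd_conv_nth)
        qed
        moreover have "hd p \<in> set p" "hd p \<in> ?S"
          using 2 chain_nonempty[OF 2(2)] by (simp_all add: chain_def)
        ultimately show ?thesis by blast
      qed
      moreover have "hd p \<in> ?S" using 2 by (simp add: chain_def)
      ultimately show ?thesis using H 2 by blast
    qed
  qed
qed

end

theorem lemma3p5:
  fixes B :: "'a sgraph" and t :: nat and f :: "'a set \<Rightarrow> nat" and C :: "'a list"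
  assumes "finite_simple_graph B"
    and "\<not> regular_graph B"
    and "k_connected 2 B"
    and "max_degree B = t"
    and "proper_edge_coloring B t f"
    and "alternating_cycle B f t C"
    and "\<forall>v\<in>set C. vdegree B v = t"
  shows "\<exists>H. ear_subgraph B f t C H \<and>
    ((\<exists>x\<in>verts H. vdegree B x < t) \<or>
     (\<exists>P x y. alternating_path B f t P \<and> hd P = y \<and> last P = x \<and>
        y \<in> verts H \<and> vdegree B x < t \<and> set P \<inter> verts H = {y} \<and>
        (\<forall>e\<in>edges B. f e = t \<and> x \<in> e \<longrightarrow> e \<in> set (edge_list P))))"
proof -
  interpret properly_colored_graph B t f
    using assms by unfold_locales
  have conn: "connected_graph (delete_verts B {})"
    using assms(3) by (simp add: k_connected_def)
  \<comment> \<open>Non-regularity rules out \<open>t\<close> as a common degree; the maximum then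
    turns a degree different from \<open>t\<close> into a smaller one.\<close>
  obtain v where v: "v \<in> verts B" "vdegree B v \<noteq> t"
    using assms(2) by (auto simp: regular_graph_def)
  moreover have "vdegree B v \<le> max_degree B"
    using v assms(1) unfolding max_degree_def finite_simple_graph_def by (intro Max_ge) auto
  ultimately have "vdegree B v < t" using assms(4) by simp
  moreover have "is_cycle B C" using assms(6) by (simp add: alternating_cycle_def)
  moreover have "ears C []" by (simp add: ears_def)
  moreover have "color_closed (verts (ear_union C []))"
    using color_closed_alternating_cycle[OF assms(6)] by (simp add: ear_union_def)
  ultimately show ?thesis
    using ear_subgraph_reaching_low_degree[OF conn] v by blast
qed

end
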